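(* For each $a\in\mathbb{D}$, the ideal $P_a=\ker(\mathrm{ev}_a)$ is prime in $\mathcal{R}_{\mathbb{R}}$.
   Context: $\mathbb{D}=\{z\in\mathbb{C}:|z|<1\}$ is the open unit disk and $\mathcal{O}(\mathbb{D})$ is the ring of holomorphic functions on $\mathbb{D}$. $\mathcal{R}_{\mathbb{R}}=\mathbb{Z}[[z]]\cap\mathcal{O}(\mathbb{D})$ is the ring of holomorphic functions on $\mathbb{D}$ all of whose Taylor coefficients at $0$ are integers. For $a\in\mathbb{D}$, $\mathrm{ev}_a:\mathcal{R}_{\mathbb{R}}\to\mathbb{C}$ is the evaluation map $f\mapsto f(a)$. *)

theory Defs
  imports
    "HOL-Complex_Analysis.Complex_Analysis"
    "HOL-Algebra.Algebraic_Closure_Type"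
begin

abbreviation unit_disk :: "complex set" where
  "unit_disk \<equiv> ball 0 1"

(* Functions on the disk are represented by extensional functions (value "undefined" off the
   disk), so that HOL equality of ring elements is equality of functions on the disk. *)
definition holo_ring :: "(complex \<Rightarrow> complex) ring" where
  "holo_ring = \<lparr>
     carrier = {f \<in> extensional unit_disk. f holomorphic_on unit_disk},
     monoid.mult = (\<lambda>f g. \<lambda>z\<in>unit_disk. f z * g z),
     one = (\<lambda>z\<in>unit_disk. 1),
     ring.zero = (\<lambda>z\<in>unit_disk. 0),
     add = (\<lambda>f g. \<lambda>z\<in>unit_disk. f z + g z)\<rparr>"

(* The Taylor coefficients at 0 do not see the values off the disk, as 0 is interior. *)
definition int_holo_ring :: "(complex \<Rightarrow> complex) ring" where
  "int_holo_ring = holo_ring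
     \<lparr>carrier := {f \<in> carrier holo_ring. \<forall>n. fps_nth (fps_expansion f 0) n \<in> \<int>}\<rparr>"

definition ev :: "complex \<Rightarrow> (complex \<Rightarrow> complex) \<Rightarrow> complex" where
  "ev a f = f a"

definition ev_ideal :: "complex \<Rightarrow> (complex \<Rightarrow> complex) set" where
  "ev_ideal a = a_kernel int_holo_ring (ring_of_type_algebra :: complex ring) (ev a)"

end

theory Submission
  imports Defs
begin

text \<open>
  The complex numbers form a field, so their zero ideal is prime; the kernel of evaluation at
  \<open>a\<close> is the preimage of that ideal under a ring homomorphism, hence prime
  (\<open>primeideal_vimage\<close>). What has to be supplied is that the holomorphic functions with integer
  Taylor coefficients really are a ring: \<open>holo_ring\<close> is a commutative ring pointwise, and the
  integrality condition cuts out a subring of it because Taylor expansion at the origin turns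
  sums, negatives and products into those of formal power series, whose coefficients are
  polynomials over the integers in the coefficients of the arguments.
\<close>

lemma holo_ring_simps [simp]:
  "f \<in> carrier holo_ring \<longleftrightarrow> f \<in> extensional unit_disk \<and> f holomorphic_on unit_disk"
  "f \<otimes>\<^bsub>holo_ring\<^esub> g = (\<lambda>z\<in>unit_disk. f z * g z)"
  "f \<oplus>\<^bsub>holo_ring\<^esub> g = (\<lambda>z\<in>unit_disk. f z + g z)"
  "\<one>\<^bsub>holo_ring\<^esub> = (\<lambda>z\<in>unit_disk. 1)"
  "\<zero>\<^bsub>holo_ring\<^esub> = (\<lambda>z\<in>unit_disk. 0)"
  by (auto simp: holo_ring_def)

lemma holomorphic_on_restrict_iff [simp]:
  "restrict f A holomorphic_on A \<longleftrightarrow> f holomorphic_on A"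
  by (rule holomorphic_cong) auto

lemma restrict_uminus_add_holo:
  assumes "f \<in> carrier holo_ring"
  shows "(\<lambda>z\<in>unit_disk. - f z) \<in> carrier holo_ring"
    and "(\<lambda>z\<in>unit_disk. - f z) \<oplus>\<^bsub>holo_ring\<^esub> f = \<zero>\<^bsub>holo_ring\<^esub>"
  using assms by (simp_all add: holomorphic_on_minus fun_eq_iff)

lemma cring_holo_ring: "cring holo_ring"
proof (rule cringI)
  show "abelian_group holo_ring"
  proof (rule abelian_groupI)
    fix f assume "f \<in> carrier holo_ring"
    then show "\<exists>g\<in>carrier holo_ring. g \<oplus>\<^bsub>holo_ring\<^esub> f = \<zero>\<^bsub>holo_ring\<^esub>"
      using restrict_uminus_add_holo by blast
  qed (auto intro!: holomorphic_intros extensionalityI[where A = unit_disk])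
  show "comm_monoid holo_ring"
    by (rule comm_monoidI)
       (auto intro!: holomorphic_intros extensionalityI[where A = unit_disk])
qed (simp add: fun_eq_iff distrib_right)

lemma a_inv_holo_ring:
  assumes "f \<in> carrier holo_ring"
  shows "\<ominus>\<^bsub>holo_ring\<^esub> f = (\<lambda>z\<in>unit_disk. - f z)"
proof -
  interpret cring holo_ring by (rule cring_holo_ring)
  show ?thesis
    by (rule minus_equality[OF restrict_uminus_add_holo(2)[OF assms] assms
          restrict_uminus_add_holo(1)[OF assms]])
qed

text \<open>
  Ring operations of \<open>holo_ring\<close> produce restricted functions; since the disk is a neighbourhood
  of the origin, restricting to it leaves the germ there, and so the Taylor series, unchanged.
\<close>
lemma fps_expansion_restrict_eqI:
  assumes "f has_fps_expansion F"
  shows "fps_expansion (restrict f unit_disk) 0 = F"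
proof -
  have "\<forall>\<^sub>F z in nhds 0. z \<in> unit_disk"
    by (intro eventually_nhds_in_open) auto
  then have "\<forall>\<^sub>F z in nhds 0. restrict f unit_disk z = f z"
    by eventually_elim simp
  then show ?thesis
    by (simp only: fps_expansion_cong fps_expansion_eqI[OF assms])
qed

lemma holo_ring_has_fps_expansion:
  assumes "f \<in> carrier holo_ring"
  shows "f has_fps_expansion fps_expansion f 0"
  using assms by (intro has_fps_expansion_fps_expansion[of unit_disk]) auto

lemma fps_expansion_holo_ring:
  assumes "f \<in> carrier holo_ring" "g \<in> carrier holo_ring"
  shows "fps_expansion (f \<oplus>\<^bsub>holo_ring\<^esub> g) 0 = fps_expansion f 0 + fps_expansion g 0"
    and "fps_expansion (f \<otimes>\<^bsub>holo_ring\<^esub> g) 0 = fps_expansion f 0 * fps_expansion g 0"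
    and "fps_expansion (\<ominus>\<^bsub>holo_ring\<^esub> f) 0 = - fps_expansion f 0"
    and "fps_expansion \<one>\<^bsub>holo_ring\<^esub> 0 = 1"
proof -
  note expansions = assms[THEN holo_ring_has_fps_expansion]
  show "fps_expansion (f \<oplus>\<^bsub>holo_ring\<^esub> g) 0 = fps_expansion f 0 + fps_expansion g 0"
    using fps_expansion_restrict_eqI[OF has_fps_expansion_add[OF expansions]] by simp
  show "fps_expansion (f \<otimes>\<^bsub>holo_ring\<^esub> g) 0 = fps_expansion f 0 * fps_expansion g 0"
    using fps_expansion_restrict_eqI[OF has_fps_expansion_mult[OF expansions]] by simp
  show "fps_expansion (\<ominus>\<^bsub>holo_ring\<^esub> f) 0 = - fps_expansion f 0"
    using fps_expansion_restrict_eqI[OF has_fps_expansion_minus[OF expansions(1)]]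
    by (simp add: a_inv_holo_ring[OF assms(1)])
  show "fps_expansion \<one>\<^bsub>holo_ring\<^esub> 0 = 1"
    using fps_expansion_restrict_eqI[OF has_fps_expansion_1] by simp
qed

lemma cring_int_holo_ring: "cring int_holo_ring"
proof -
  interpret cring holo_ring by (rule cring_holo_ring)
  let ?H = "{f \<in> carrier holo_ring. \<forall>n. fps_nth (fps_expansion f 0) n \<in> \<int>}"
  have "subring ?H holo_ring"
  proof (rule subringI)
    have "fps_nth (fps_expansion \<one>\<^bsub>holo_ring\<^esub> 0) n \<in> \<int>" for n
      unfolding fps_expansion_holo_ring(4)[OF one_closed one_closed] by simp
    then show "\<one>\<^bsub>holo_ring\<^esub> \<in> ?H"
      using one_closed by blast
  next
    fix f assume "f \<in> ?H"
    then show "\<ominus>\<^bsub>holo_ring\<^esub> f \<in> ?H"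
      by (simp add: fps_expansion_holo_ring(3)[of f f] del: holo_ring_simps)
  next
    fix f g assume *: "f \<in> ?H" "g \<in> ?H"
    then show "f \<oplus>\<^bsub>holo_ring\<^esub> g \<in> ?H"
      by (simp add: fps_expansion_holo_ring(1) del: holo_ring_simps)
    have "fps_nth (fps_expansion f 0 * fps_expansion g 0) n \<in> \<int>" for n
      unfolding fps_mult_nth using * by (intro Ints_sum Ints_mult) auto
    then show "f \<otimes>\<^bsub>holo_ring\<^esub> g \<in> ?H"
      using * by (simp add: fps_expansion_holo_ring(2) del: holo_ring_simps)
  qed blast
  then have "subcring ?H holo_ring"
    by (rule subcringI')
  then show ?thesis
    unfolding int_holo_ring_def by (subst (asm) subcring_iff) blast
qed

lemma ring_hom_ev:
  assumes "a \<in> unit_disk"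
  shows "ring_hom_ring int_holo_ring (ring_of_type_algebra :: complex ring) (ev a)"
  using assms cring.axioms(1)[OF cring_int_holo_ring]
  by (intro ring_hom_ringI ring_from_type_algebra)
     (auto simp: int_holo_ring_def ring_of_type_algebra_def ev_def)

theorem proposition7p1:
  fixes a :: complex
  assumes "a \<in> unit_disk"
  shows "primeideal (ev_ideal a) int_holo_ring"
proof -
  let ?C = "ring_of_type_algebra :: complex ring"
  have "domain ?C"
    using field_from_type_algebra by (rule field.axioms)
  then have "primeideal {\<zero>\<^bsub>?C\<^esub>} ?C"
    by (rule domain.zeroprimeideal)
  from ring_hom_ring.primeideal_vimage[OF ring_hom_ev[OF assms] cring_int_holo_ring this]
  show ?thesis
    by (simp add: ev_ideal_def a_kernel_def')
qed

end
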